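(* Let $G$ be a finitely generated infinite group and let $X$ be a $G$-subshift. The following are equivalent: (1) $X$ has the map extension property; (2) $X$ is a contractible subshift of finite type with the map existence property; (3) $X$ is a strongly contractible subshift of finite type with the map existence property.
   Context: For a finite set $A$ (alphabet) and a group $G$, $A^G$ carries the product topology (discrete $A$) and the shift action $(gx)_h = x_{g^{-1}h}$. A subshift is a topologically closed, shift-invariant subset $X \subset A^G$ (possibly empty). A finite pattern is an element $p \in A^D$ with $D \subset G$ finite; it appears in $x \in A^G$ if for some $g \in G$ one has $x_{gd} = p_d$ for all $d \in D$. $X$ is of finite type (SFT) if there is a finite set of finite patterns such that $X$ is the set of all $x \in A^G$ in which none of them appears. A block map (morphism) between $G$-subshifts is a continuous shift-commuting map; products carry the diagonal action. Let $I = \{0,1\}^G$, with constant configurations $\bar 0, \bar 1$. A subshift $X$ is contractible if there is a block map $h : I \times X \times X \to X$ with $h(\bar 0, x, y) = x$ and $h(\bar 1, x, y) = y$ for all $x, y \in X$; it is strongly contractible if such an $h$ can be chosen with additionally $h(t,x,x) = x$ for all $t \in I$, $x \in X$. For $G$-subshifts $X, Y$ write $X \leq_{\mathrm{per}} Y$ if for all $x \in X$ there exists $y \in Y$ with $\mathrm{stab}(x) \leq \mathrm{stab}(y)$ (stabilizers in $G$ under the shift action). A $G$-subshift $Y$ has the map extension property if for every $G$-subshift $X$ with $X \leq_{\mathrm{per}} Y$, every subshift $X' \subset X$ (possibly empty) and every morphism $g : X' \to Y$, there exists a morphism $f : X \to Y$ with $f|_{X'} = g$. A $G$-subshift $Y$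 has the map existence property if for every $G$-subshift $X$ with $X \leq_{\mathrm{per}} Y$ there is a morphism $f : X \to Y$. *)

theory Defs
  imports "HOL-Analysis.Function_Topology" "HOL-Analysis.Product_Topology" "HOL-Algebra.Group_Action" "HOL-Algebra.Generated_Groups"
begin

definition finitely_generated :: "('g, 'm) monoid_scheme \<Rightarrow> bool" where
  "finitely_generated G \<longleftrightarrow> (\<exists>S. finite S \<and> S \<subseteq> carrier G \<and> generate G S = carrier G)"

text \<open>Configurations are extensional functions on \<open>carrier G\<close>, i.e. elements of
  \<open>carrier G \<rightarrow>\<^sub>E A\<close>, which is the carrier of the following space.\<close>

definition full_shift :: "('g, 'm) monoid_scheme \<Rightarrow> 'a set \<Rightarrow> ('g \<Rightarrow> 'a) topology" where
  "full_shift G A = product_topology (\<lambda>_. discrete_topology A) (carrier G)"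

definition shift :: "('g, 'm) monoid_scheme \<Rightarrow> 'g \<Rightarrow> ('g \<Rightarrow> 'a) \<Rightarrow> 'g \<Rightarrow> 'a" where
  "shift G g x = (\<lambda>h\<in>carrier G. x (inv\<^bsub>G\<^esub> g \<otimes>\<^bsub>G\<^esub> h))"

definition subshift :: "('g, 'm) monoid_scheme \<Rightarrow> 'a set \<Rightarrow> ('g \<Rightarrow> 'a) set \<Rightarrow> bool" where
  "subshift G A X \<longleftrightarrow> finite A \<and> closedin (full_shift G A) X \<and>
     (\<forall>g\<in>carrier G. \<forall>x\<in>X. shift G g x \<in> X)"

text \<open>A pattern \<open>p \<in> A\<^sup>D\<close> is represented by the pair \<open>(D, p)\<close>, with \<open>p\<close> extensional on \<open>D\<close>.\<close>

definition finite_pattern :: "('g, 'm) monoid_scheme \<Rightarrow> 'a set \<Rightarrow> 'g set \<times> ('g \<Rightarrow> 'a) \<Rightarrow> bool" where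
  "finite_pattern G A = (\<lambda>(D, p). finite D \<and> D \<subseteq> carrier G \<and> p \<in> D \<rightarrow>\<^sub>E A)"

definition appears :: "('g, 'm) monoid_scheme \<Rightarrow> 'g set \<times> ('g \<Rightarrow> 'a) \<Rightarrow> ('g \<Rightarrow> 'a) \<Rightarrow> bool" where
  "appears G = (\<lambda>(D, p) x. \<exists>g\<in>carrier G. \<forall>d\<in>D. x (g \<otimes>\<^bsub>G\<^esub> d) = p d)"

definition finite_type :: "('g, 'm) monoid_scheme \<Rightarrow> 'a set \<Rightarrow> ('g \<Rightarrow> 'a) set \<Rightarrow> bool" where
  "finite_type G A X \<longleftrightarrow> (\<exists>F. finite F \<and> (\<forall>P\<in>F. finite_pattern G A P) \<and>
     X = {x \<in> topspace (full_shift G A). \<forall>P\<in>F. \<not> appears G P x})"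

definition equivariant_map ::
  "('g, 'm) monoid_scheme \<Rightarrow> 'x topology \<Rightarrow> ('g \<Rightarrow> 'x \<Rightarrow> 'x) \<Rightarrow>
   'y topology \<Rightarrow> ('g \<Rightarrow> 'y \<Rightarrow> 'y) \<Rightarrow> ('x \<Rightarrow> 'y) \<Rightarrow> bool" where
  "equivariant_map G S \<alpha> T \<beta> f \<longleftrightarrow> continuous_map S T f \<and>
     (\<forall>g\<in>carrier G. \<forall>x\<in>topspace S. f (\<alpha> g x) = \<beta> g (f x))"

definition block_map ::
  "('g, 'm) monoid_scheme \<Rightarrow> 'a set \<Rightarrow> ('g \<Rightarrow> 'a) set \<Rightarrow> 'b set \<Rightarrow> ('g \<Rightarrow> 'b) set \<Rightarrow>
   (('g \<Rightarrow> 'a) \<Rightarrow> 'g \<Rightarrow> 'b) \<Rightarrow> bool" where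
  "block_map G A X B Y f \<longleftrightarrow>
     equivariant_map G (subtopology (full_shift G A) X) (shift G)
       (subtopology (full_shift G B) Y) (shift G) f"

definition contraction ::
  "('g, 'm) monoid_scheme \<Rightarrow> 'a set \<Rightarrow> ('g \<Rightarrow> 'a) set \<Rightarrow>
   (('g \<Rightarrow> nat) \<times> ('g \<Rightarrow> 'a) \<times> ('g \<Rightarrow> 'a) \<Rightarrow> 'g \<Rightarrow> 'a) \<Rightarrow> bool" where
  "contraction G A X h \<longleftrightarrow>
     equivariant_map G
       (prod_topology (full_shift G {0, 1})
         (prod_topology (subtopology (full_shift G A) X) (subtopology (full_shift G A) X)))
       (\<lambda>g (t, x, y). (shift G g t, shift G g x, shift G g y))
       (subtopology (full_shift G A) X) (shift G) h \<and>
     (\<forall>x\<in>X. \<forall>y\<in>X. h (\<lambda>_\<in>carrier G. 0, x, y) = x \<and> h (\<lambda>_\<in>carrier G. 1, x, y) = y)"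

definition contractible_subshift ::
  "('g, 'm) monoid_scheme \<Rightarrow> 'a set \<Rightarrow> ('g \<Rightarrow> 'a) set \<Rightarrow> bool" where
  "contractible_subshift G A X \<longleftrightarrow> (\<exists>h. contraction G A X h)"

definition strongly_contractible_subshift ::
  "('g, 'm) monoid_scheme \<Rightarrow> 'a set \<Rightarrow> ('g \<Rightarrow> 'a) set \<Rightarrow> bool" where
  "strongly_contractible_subshift G A X \<longleftrightarrow>
     (\<exists>h. contraction G A X h \<and>
       (\<forall>t\<in>topspace (full_shift G {0, 1}). \<forall>x\<in>X. h (t, x, x) = x))"

definition le_per ::
  "('g, 'm) monoid_scheme \<Rightarrow> ('g \<Rightarrow> 'a) set \<Rightarrow> ('g \<Rightarrow> 'b) set \<Rightarrow> bool" where
  "le_per G X Y \<longleftrightarrow>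
     (\<forall>x\<in>X. \<exists>y\<in>Y. stabilizer G (shift G) x \<subseteq> stabilizer G (shift G) y)"

text \<open>HOL cannot quantify over types inside a definition, so in the next two definitions the
  alphabet of the test subshift \<open>X\<close> ranges over the finite sets of natural numbers. The lemmas
  \<open>map_extension_property_alphabet\<close> and \<open>map_existence_property_alphabet\<close> below show that the
  properties so defined hold for test subshifts over every finite alphabet in every type.\<close>

definition map_extension_property ::
  "('g, 'm) monoid_scheme \<Rightarrow> 'a set \<Rightarrow> ('g \<Rightarrow> 'a) set \<Rightarrow> bool" where
  "map_extension_property G A Y \<longleftrightarrow>
     (\<forall>(B :: nat set) X X' g.
        subshift G B X \<and> le_per G X Y \<and> subshift G B X' \<and> X' \<subseteq> X \<and> block_map G B X' A Y g \<longrightarrow>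
        (\<exists>f. block_map G B X A Y f \<and> (\<forall>x\<in>X'. f x = g x)))"

definition map_existence_property ::
  "('g, 'm) monoid_scheme \<Rightarrow> 'a set \<Rightarrow> ('g \<Rightarrow> 'a) set \<Rightarrow> bool" where
  "map_existence_property G A Y \<longleftrightarrow>
     (\<forall>(B :: nat set) X. subshift G B X \<and> le_per G X Y \<longrightarrow> (\<exists>f. block_map G B X A Y f))"


lemma topspace_full_shift: "topspace (full_shift G A) = carrier G \<rightarrow>\<^sub>E A"
  by (simp add: full_shift_def)

definition recode :: "('g, 'm) monoid_scheme \<Rightarrow> ('a \<Rightarrow> 'b) \<Rightarrow> ('g \<Rightarrow> 'a) \<Rightarrow> 'g \<Rightarrow> 'b" where
  "recode G e x = (\<lambda>h\<in>carrier G. e (x h))"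

lemma continuous_map_recode:
  assumes "e \<in> A \<rightarrow> B"
  shows "continuous_map (full_shift G A) (full_shift G B) (recode G e)"
proof -
  have "continuous_map (full_shift G A) (discrete_topology B) (\<lambda>x. recode G e x k)"
    if k: "k \<in> carrier G" for k
  proof -
    have "continuous_map (full_shift G A) (discrete_topology A) (\<lambda>x. x k)"
      unfolding full_shift_def using k by (rule continuous_map_product_projection)
    moreover have "continuous_map (discrete_topology A) (discrete_topology B) e"
      using assms by simp
    ultimately have "continuous_map (full_shift G A) (discrete_topology B) (e \<circ> (\<lambda>x. x k))"
      by (rule continuous_map_compose)
    then show ?thesis
      using k by (simp add: recode_def o_def)
  qed
  moreover have "recode G e ` topspace (full_shift G A) \<subseteq> extensional (carrier G)"
    by (auto simp: recode_def)
  ultimately show ?thesis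
    unfolding full_shift_def[of G B] continuous_map_componentwise by blast
qed

lemma recode_shift:
  assumes "group G" "g \<in> carrier G"
  shows "recode G e (shift G g x) = shift G g (recode G e x)"
proof
  fix k
  interpret group G by fact
  show "recode G e (shift G g x) k = shift G g (recode G e x) k"
    using assms(2) by (cases "k \<in> carrier G") (simp_all add: recode_def shift_def)
qed

lemma recode_recode:
  assumes "x \<in> carrier G \<rightarrow>\<^sub>E A" "\<And>a. a \<in> A \<Longrightarrow> e' (e a) = a"
  shows "recode G e' (recode G e x) = x"
proof
  fix k
  show "recode G e' (recode G e x) k = x k"
    using assms(2) PiE_mem[OF assms(1), of k] PiE_arb[OF assms(1), of k]
    by (cases "k \<in> carrier G") (simp_all add: recode_def)
qed

lemma subshift_subset: "subshift G A X \<Longrightarrow> X \<subseteq> carrier G \<rightarrow>\<^sub>E A"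
  unfolding subshift_def using closedin_subset topspace_full_shift by metis

lemma recode_inverse_image:
  assumes "X \<subseteq> carrier G \<rightarrow>\<^sub>E A" "e \<in> A \<rightarrow> B"
    and "\<And>a. a \<in> A \<Longrightarrow> e' (e a) = a" "\<And>b. b \<in> B \<Longrightarrow> e (e' b) = b"
  shows "recode G e ` X = {y \<in> topspace (full_shift G B). recode G e' y \<in> X}" (is "?L = ?R")
proof
  show "?L \<subseteq> ?R"
  proof
    fix y assume "y \<in> ?L"
    then obtain x where x: "x \<in> X" "y = recode G e x" by blast
    then have "x \<in> carrier G \<rightarrow>\<^sub>E A" using assms(1) by blast
    moreover from this have "recode G e' y = x"
      using x assms(3) recode_recode by metis
    ultimately show "y \<in> ?R"
      using x assms(2) by (auto simp: topspace_full_shift recode_def PiE_iff)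
  qed
  show "?R \<subseteq> ?L"
  proof
    fix y assume y: "y \<in> ?R"
    then have "recode G e (recode G e' y) = y"
      using recode_recode[of y G B e e'] assms(4) by (simp add: topspace_full_shift)
    then show "y \<in> ?L" using y by force
  qed
qed

lemma subshift_recode:
  assumes "group G" "subshift G A X" "bij_betw e A B"
  shows "subshift G B (recode G e ` X)"
proof -
  let ?e' = "inv_into A e"
  have inv: "\<And>a. a \<in> A \<Longrightarrow> ?e' (e a) = a" "\<And>b. b \<in> B \<Longrightarrow> e (?e' b) = b"
    using assms(3) by (auto simp: bij_betw_inv_into_left bij_betw_inv_into_right)
  have maps: "e \<in> A \<rightarrow> B" "?e' \<in> B \<rightarrow> A"
    using bij_betw_imp_funcset[OF assms(3)]
      bij_betw_imp_funcset[OF bij_betw_inv_into[OF assms(3)]] by auto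
  have img: "recode G e ` X = {y \<in> topspace (full_shift G B). recode G ?e' y \<in> X}"
    by (rule recode_inverse_image[OF subshift_subset[OF assms(2)] maps(1)]) (simp_all add: inv)
  have "closedin (full_shift G B) (recode G e ` X)"
    unfolding img
    by (rule closedin_continuous_map_preimage[OF continuous_map_recode[OF maps(2)]])
      (use assms(2) in \<open>simp add: subshift_def\<close>)
  moreover have "finite B"
    using assms(2,3) bij_betw_finite by (auto simp: subshift_def)
  moreover have "shift G g (recode G e x) \<in> recode G e ` X" if "g \<in> carrier G" "x \<in> X" for g x
    using that assms(1,2) by (metis recode_shift subshift_def imageI)
  ultimately show ?thesis
    by (auto simp: subshift_def)
qed

lemma block_map_recode:
  assumes "group G" "e \<in> A \<rightarrow> B" "recode G e ` X \<subseteq> Z" "X \<subseteq> carrier G \<rightarrow>\<^sub>E A"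
    and f: "block_map G B Z C Y f"
  shows "block_map G A X C Y (f \<circ> recode G e)"
proof -
  have "continuous_map (subtopology (full_shift G A) X) (subtopology (full_shift G B) Z) (recode G e)"
    using continuous_map_recode[OF assms(2), of G] assms(3)
    by (auto simp: continuous_map_in_subtopology intro: continuous_map_from_subtopology)
  moreover have "recode G e x \<in> topspace (subtopology (full_shift G B) Z)" if "x \<in> X" for x
    using that assms(2,3,4) by (auto simp: topspace_full_shift recode_def)
  ultimately show ?thesis
    using f assms(1) unfolding block_map_def equivariant_map_def
    by (auto simp: recode_shift intro: continuous_map_compose)
qed

lemma stabilizer_recode:
  assumes "group G" "x \<in> carrier G \<rightarrow>\<^sub>E A" "\<And>a. a \<in> A \<Longrightarrow> e' (e a) = a"
  shows "stabilizer G (shift G) (recode G e x) = stabilizer G (shift G) x"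
proof -
  interpret group G by fact
  have "shift G g (recode G e x) = recode G e x \<longleftrightarrow> shift G g x = x" if g: "g \<in> carrier G" for g
  proof -
    have "shift G g x \<in> carrier G \<rightarrow>\<^sub>E A"
      using assms(2) g by (auto simp: shift_def)
    then have "recode G e (shift G g x) = recode G e x \<longleftrightarrow> shift G g x = x"
      using assms(2,3) recode_recode[where e = e and e' = e'] by metis
    then show ?thesis
      using recode_shift[OF assms(1) g] by metis
  qed
  then show ?thesis by (auto simp: stabilizer_def)
qed

lemma le_per_recode:
  assumes "group G" "X \<subseteq> carrier G \<rightarrow>\<^sub>E A" "\<And>a. a \<in> A \<Longrightarrow> e' (e a) = a" "le_per G X Y"
  shows "le_per G (recode G e ` X) Y"
proof -
  have "stabilizer G (shift G) (recode G e x) = stabilizer G (shift G) x" if "x \<in> X" for x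
    using stabilizer_recode[of G x A e' e] assms that by blast
  then show ?thesis using assms(4) by (simp add: le_per_def)
qed

lemma map_extension_property_alphabet:
  fixes B :: "'b set"
  assumes "group G" "map_extension_property G A Y"
    and X: "subshift G B X" "le_per G X Y"
    and X': "subshift G B X'" "X' \<subseteq> X" and g: "block_map G B X' A Y g"
  shows "\<exists>f. block_map G B X A Y f \<and> (\<forall>x\<in>X'. f x = g x)"
proof -
  obtain e :: "'b \<Rightarrow> nat" and N where e: "bij_betw e B N"
    using X(1) ex_bij_betw_finite_nat unfolding subshift_def by blast
  define e' where "e' = inv_into B e"
  have inv: "\<And>b. b \<in> B \<Longrightarrow> e' (e b) = b"
    using e by (simp add: e'_def bij_betw_inv_into_left)
  have maps: "e \<in> B \<rightarrow> N" "e' \<in> N \<rightarrow> B"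
    using bij_betw_imp_funcset[OF e] bij_betw_imp_funcset[OF bij_betw_inv_into[OF e]]
    by (auto simp: e'_def)
  note sub = subshift_subset[OF X(1)] subshift_subset[OF X'(1)]
  have rr: "recode G e' (recode G e x) = x" if "x \<in> X" for x
    using recode_recode[of x G B e' e] inv sub(1) that by blast
  have "block_map G N (recode G e ` X') A Y (g \<circ> recode G e')"
    using assms(1) maps(2) rr X'(2) g subshift_subset[OF subshift_recode[OF assms(1) X'(1) e]]
    by (intro block_map_recode[where Z = X']) auto
  moreover have "le_per G (recode G e ` X) Y"
    using le_per_recode[of G X B e' e Y] assms(1) sub(1) inv X(2) by blast
  ultimately have "subshift G N (recode G e ` X) \<and> le_per G (recode G e ` X) Y \<and>
      subshift G N (recode G e ` X') \<and> recode G e ` X' \<subseteq> recode G e ` X \<and>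
      block_map G N (recode G e ` X') A Y (g \<circ> recode G e')"
    by (intro conjI subshift_recode[OF assms(1) X(1) e] subshift_recode[OF assms(1) X'(1) e]
        image_mono X'(2))
  then have "\<exists>f. block_map G N (recode G e ` X) A Y f \<and>
      (\<forall>z\<in>recode G e ` X'. f z = (g \<circ> recode G e') z)"
    by (rule assms(2)[unfolded map_extension_property_def, THEN spec, THEN spec, THEN spec,
        THEN spec, THEN mp])
  then obtain f where f: "block_map G N (recode G e ` X) A Y f"
      "\<forall>z\<in>recode G e ` X'. f z = (g \<circ> recode G e') z"
    by blast
  have "block_map G B X A Y (f \<circ> recode G e)"
    using block_map_recode[OF assms(1) maps(1) order_refl sub(1) f(1)] .
  moreover have "(f \<circ> recode G e) x = g x" if x: "x \<in> X'" for x
    using f(2) rr[of x] X'(2) x by auto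
  ultimately show ?thesis by blast
qed

lemma map_existence_property_alphabet:
  fixes B :: "'b set"
  assumes "group G" "map_existence_property G A Y" "subshift G B X" "le_per G X Y"
  shows "\<exists>f. block_map G B X A Y f"
proof -
  obtain e :: "'b \<Rightarrow> nat" and N where e: "bij_betw e B N"
    using assms(3) ex_bij_betw_finite_nat unfolding subshift_def by blast
  note sub = subshift_subset[OF assms(3)]
  have "le_per G (recode G e ` X) Y"
    using le_per_recode[of G X B "inv_into B e" e Y] assms(1,4) sub e
    by (auto simp: bij_betw_inv_into_left)
  then obtain f where "block_map G N (recode G e ` X) A Y f"
    using assms(2) subshift_recode[OF assms(1,3) e] unfolding map_existence_property_def by blast
  then show ?thesis
    using block_map_recode[OF assms(1) bij_betw_imp_funcset[OF e] order_refl sub] by blast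
qed

end

theory Submission
  imports Defs
begin

text \<open>By compactness, a morphism is computed through a finite window, and a subshift has finite
  type iff membership is decided by the patterns on a finite window. If \<open>X\<close> has the
  extension property, then extending the first projection \<open>X \<times> X \<rightarrow> X\<close> to \<open>A\<^sup>G \<times> X\<close> yields a local
  test for membership in \<open>X\<close>, and extending the prescribed boundary values to \<open>I \<times> X \<times> X\<close> yields
  a strong contraction. Conversely, given a contraction \<open>h\<close> of an SFT \<open>X\<close>, a morphism
  \<open>g : Z' \<rightarrow> X\<close> and any morphism \<open>f\<^sub>0 : Z \<rightarrow> X\<close>, use \<open>h\<close> to interpolate between \<open>g\<close>, which makes sense
  locally where \<open>z \<in> Z\<close> looks like a point of \<open>Z'\<close>, and \<open>f\<^sub>0 z\<close>, used everywhere else.\<close>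

subsection \<open>Subshifts and patterns\<close>

lemma shift_in_full_shift:
  assumes "group G" "g \<in> carrier G" "x \<in> carrier G \<rightarrow>\<^sub>E A"
  shows "shift G g x \<in> carrier G \<rightarrow>\<^sub>E A"
proof -
  interpret group G by fact
  show ?thesis using assms(2,3) by (auto simp: shift_def)
qed

lemma subshift_in_full_shift: "subshift G A X \<Longrightarrow> x \<in> X \<Longrightarrow> x \<in> carrier G \<rightarrow>\<^sub>E A"
  using subshift_subset by blast

section \<open>Cylinders, compactness and finite windows\<close>

text \<open>The cylinder is a box with factor \<open>{x k}\<close> over \<open>D\<close> and
  \<open>A\<close> elsewhere, so only finitely many factors differ from \<open>A\<close>.\<close>

lemma openin_cylinder:
  assumes "finite D" "D \<subseteq> carrier G" "x \<in> carrier G \<rightarrow>\<^sub>E A"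
  shows "openin (full_shift G A) {y \<in> carrier G \<rightarrow>\<^sub>E A. \<forall>d\<in>D. y d = x d}"
proof -
  have eq: "{y \<in> carrier G \<rightarrow>\<^sub>E A. \<forall>d\<in>D. y d = x d} =
      (\<Pi>\<^sub>E k\<in>carrier G. if k \<in> D then {x k} else A)"
  proof (intro equalityI subsetI)
    fix y assume "y \<in> (\<Pi>\<^sub>E k\<in>carrier G. if k \<in> D then {x k} else A)"
    then have "y \<in> extensional (carrier G)"
      and *: "\<And>k. k \<in> carrier G \<Longrightarrow> y k \<in> (if k \<in> D then {x k} else A)"
      by (auto simp: PiE_iff)
    moreover have "y k \<in> A" if "k \<in> carrier G" for k
      using *[OF that] PiE_mem[OF assms(3) that] by (auto split: if_splits)
    ultimately show "y \<in> {y \<in> carrier G \<rightarrow>\<^sub>E A. \<forall>d\<in>D. y d = x d}"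
      using *[OF subsetD[OF assms(2)]] by (auto simp: PiE_iff)
  qed (use assms(3) in \<open>auto simp: PiE_iff\<close>)
  have "finite {k \<in> carrier G. (if k \<in> D then {x k} else A) \<noteq> A}"
    by (rule finite_subset[OF _ assms(1)]) auto
  then show ?thesis
    using assms(3) unfolding eq full_shift_def by (subst openin_PiE_gen) auto
qed

text \<open>\<open>D\<close> collects the coordinates constrained by a basic open box around
  \<open>x\<close>.\<close>

lemma open_contains_cylinder:
  assumes "openin (full_shift G A) U" "x \<in> U"
  obtains D where "finite D" "D \<subseteq> carrier G"
    "{y \<in> carrier G \<rightarrow>\<^sub>E A. \<forall>d\<in>D. y d = x d} \<subseteq> U"
proof -
  obtain V where V: "finite {k \<in> carrier G. V k \<noteq> A}" "x \<in> Pi\<^sub>E (carrier G) V"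
      "Pi\<^sub>E (carrier G) V \<subseteq> U"
    using assms unfolding full_shift_def openin_product_topology_alt by auto
  show thesis
  proof (rule that[OF V(1)])
    show "{y \<in> carrier G \<rightarrow>\<^sub>E A. \<forall>d\<in>{k \<in> carrier G. V k \<noteq> A}. y d = x d} \<subseteq> U"
    proof
      fix y assume y: "y \<in> {y \<in> carrier G \<rightarrow>\<^sub>E A. \<forall>d\<in>{k \<in> carrier G. V k \<noteq> A}. y d = x d}"
      have "y k \<in> V k" if "k \<in> carrier G" for k
        using y V(2) that by (cases "V k = A") (auto simp: PiE_iff)
      then have "y \<in> Pi\<^sub>E (carrier G) V"
        using y unfolding PiE_iff by blast
      then show "y \<in> U" using V(3) by blast
    qed
  qed auto
qed

text \<open>Tychonoff: a finite discrete alphabet is compact, hence so is the full shift, in which a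
  subshift is closed.\<close>

lemma compactin_subshift:
  assumes "subshift G A X"
  shows "compactin (full_shift G A) X"
  using assms closedin_compact_space[of "full_shift G A" X]
  unfolding subshift_def
  by (simp add: full_shift_def compact_space_product_topology compact_space_discrete_topology)

text \<open>By compactness, continuity at all points is witnessed by one common window.\<close>

lemma continuous_map_discrete_window:
  assumes X: "subshift G A X"
  shows "continuous_map (subtopology (full_shift G A) X) (discrete_topology B) \<phi> \<longleftrightarrow>
    \<phi> ` X \<subseteq> B \<and> (\<exists>D. finite D \<and> D \<subseteq> carrier G \<and>
      (\<forall>x\<in>X. \<forall>y\<in>X. (\<forall>d\<in>D. x d = y d) \<longrightarrow> \<phi> x = \<phi> y))"
    (is "?L \<longleftrightarrow> ?R")
proof
  have top: "topspace (subtopology (full_shift G A) X) = X"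
    using subshift_subset[OF X] by (auto simp: topspace_full_shift)
  {
    assume L: ?L
    define C where "C x D = {y \<in> carrier G \<rightarrow>\<^sub>E A. \<forall>d\<in>D. y d = x d}" for x :: "'a \<Rightarrow> 'c" and D
    have "\<exists>D. finite D \<and> D \<subseteq> carrier G \<and> (\<forall>y\<in>X. y \<in> C x D \<longrightarrow> \<phi> y = \<phi> x)" if x: "x \<in> X" for x
    proof -
      have "openin (subtopology (full_shift G A) X)
          {y \<in> topspace (subtopology (full_shift G A) X). \<phi> y \<in> {\<phi> x}}"
        using L x top by (intro openin_continuous_map_preimage[OF L]) (auto simp: continuous_map_def)
      then obtain U where U: "openin (full_shift G A) U" "{y \<in> X. \<phi> y = \<phi> x} = U \<inter> X"
        unfolding top openin_subtopology by auto
      then have "x \<in> U" using x by blast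
      from open_contains_cylinder[OF U(1) this] obtain D where
        "finite D" "D \<subseteq> carrier G" "C x D \<subseteq> U"
        unfolding C_def .
      then show ?thesis using U(2) by blast
    qed
    then obtain D where D: "\<And>x. x \<in> X \<Longrightarrow> finite (D x)" "\<And>x. x \<in> X \<Longrightarrow> D x \<subseteq> carrier G"
        "\<And>x y. x \<in> X \<Longrightarrow> y \<in> X \<Longrightarrow> y \<in> C x (D x) \<Longrightarrow> \<phi> y = \<phi> x"
      by metis
    have "\<forall>U\<in>(\<lambda>x. C x (D x)) ` X. openin (full_shift G A) U"
      unfolding C_def using D(1,2) subshift_in_full_shift[OF X]
      by (intro ballI, elim imageE) (simp only:, rule openin_cylinder)
    moreover have "X \<subseteq> \<Union> ((\<lambda>x. C x (D x)) ` X)"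
      using subshift_in_full_shift[OF X] by (auto simp: C_def)
    ultimately obtain \<F> where \<F>: "finite \<F>" "\<F> \<subseteq> (\<lambda>x. C x (D x)) ` X" "X \<subseteq> \<Union> \<F>"
      using compactin_subshift[OF X] unfolding compactin_def by meson
    then obtain Y where Y: "Y \<subseteq> X" "finite Y" "\<F> = (\<lambda>x. C x (D x)) ` Y"
      by (meson finite_subset_image)
    \<comment> \<open>The windows of the finite subcover are united. If \<open>x\<close> lies in the
      cylinder of a centre \<open>c\<close>, agreement with \<open>x\<close> on the union puts
      \<open>y\<close> into the same cylinder, so both values equal \<open>\<phi> c\<close>.\<close>
    have "\<phi> x = \<phi> y" if "x \<in> X" "y \<in> X" and eq: "\<forall>d\<in>\<Union> (D ` Y). x d = y d" for x y
    proof -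
      obtain c where c: "c \<in> Y" "x \<in> C c (D c)" using \<F>(3) Y(3) \<open>x \<in> X\<close> by blast
      then have "y \<in> C c (D c)"
        using eq subshift_in_full_shift[OF X \<open>y \<in> X\<close>] by (auto simp: C_def)
      then show ?thesis using D(3) c Y(1) that(1,2) by (metis subsetD)
    qed
    moreover have "finite (\<Union> (D ` Y))" "\<Union> (D ` Y) \<subseteq> carrier G" using D(1,2) Y(1,2) by blast+
    moreover have "\<phi> ` X \<subseteq> B"
      using continuous_map_image_subset_topspace[OF L] top by simp
    ultimately show ?R by blast
  }
  assume ?R
  then obtain D where D: "\<phi> ` X \<subseteq> B" "finite D" "D \<subseteq> carrier G"
      "\<forall>x\<in>X. \<forall>y\<in>X. (\<forall>d\<in>D. x d = y d) \<longrightarrow> \<phi> x = \<phi> y"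
    by (elim exE conjE) (rule that)
  have "openin (subtopology (full_shift G A) X) {x \<in> X. \<phi> x \<in> U}" for U
  proof (subst openin_subopen, intro ballI)
    fix x assume x: "x \<in> {x \<in> X. \<phi> x \<in> U}"
    let ?T = "X \<inter> {y \<in> carrier G \<rightarrow>\<^sub>E A. \<forall>d\<in>D. y d = x d}"
    have "openin (subtopology (full_shift G A) X) ?T"
      using x D(2,3) subshift_in_full_shift[OF X]
      by (intro openin_subtopology_Int2 openin_cylinder) auto
    moreover have "?T \<subseteq> {x \<in> X. \<phi> x \<in> U}"
    proof
      fix y assume "y \<in> ?T"
      then show "y \<in> {x \<in> X. \<phi> x \<in> U}" using bspec[OF bspec[OF D(4)], of y x] x by auto
    qed
    ultimately show "\<exists>T. openin (subtopology (full_shift G A) X) T \<and> x \<in> T \<and> T \<subseteq> {x \<in> X. \<phi> x \<in> U}"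
      using x subshift_in_full_shift[OF X] by (intro exI[of _ ?T]) auto
  qed
  then show ?L
    using D(1) unfolding continuous_map_def top by auto
qed

section \<open>Patterns and local rules\<close>

definition same_pattern ::
  "('g, 'm) monoid_scheme \<Rightarrow> 'g set \<Rightarrow> ('g \<Rightarrow> 'a) \<Rightarrow> 'g \<Rightarrow> ('g \<Rightarrow> 'a) \<Rightarrow> 'g \<Rightarrow> bool" where
  "same_pattern G D x g y h \<longleftrightarrow> (\<forall>d\<in>D. x (g \<otimes>\<^bsub>G\<^esub> d) = y (h \<otimes>\<^bsub>G\<^esub> d))"

lemma same_patternD: "same_pattern G D x g y h \<Longrightarrow> d \<in> D \<Longrightarrow> x (g \<otimes>\<^bsub>G\<^esub> d) = y (h \<otimes>\<^bsub>G\<^esub> d)"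
  by (simp add: same_pattern_def)

lemma same_pattern_sym: "same_pattern G D x g y h \<longleftrightarrow> same_pattern G D y h x g"
  by (auto simp: same_pattern_def)

lemma same_pattern_trans:
  "same_pattern G D x g y h \<Longrightarrow> same_pattern G D y h z k \<Longrightarrow> same_pattern G D x g z k"
  by (simp add: same_pattern_def)

text \<open>A sliding block code with memory set \<open>D\<close>. Allowing different base points
  \<open>g\<close> and \<open>h\<close> encodes shift-commutation together with locality.\<close>

definition local_rule ::
  "('g, 'm) monoid_scheme \<Rightarrow> 'g set \<Rightarrow> ('g \<Rightarrow> 'a) set \<Rightarrow> (('g \<Rightarrow> 'a) \<Rightarrow> 'g \<Rightarrow> 'b) \<Rightarrow> bool" where
  "local_rule G D X f \<longleftrightarrow> finite D \<and> D \<subseteq> carrier G \<and>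
    (\<forall>x\<in>X. \<forall>y\<in>X. \<forall>g\<in>carrier G. \<forall>h\<in>carrier G. same_pattern G D x g y h \<longrightarrow> f x g = f y h)"

lemma local_ruleD:
  assumes "local_rule G D X f" "x \<in> X" "y \<in> X" "g \<in> carrier G" "h \<in> carrier G"
    "same_pattern G D x g y h"
  shows "f x g = f y h"
  using assms by (auto simp: local_rule_def)

text \<open>A product of subshifts is represented over the product alphabet, since
  \<open>subshift\<close> and \<open>block_map\<close> speak of configurations over a single
  alphabet.\<close>

definition pair_config ::
  "('g, 'm) monoid_scheme \<Rightarrow> ('g \<Rightarrow> 'a) \<Rightarrow> ('g \<Rightarrow> 'b) \<Rightarrow> 'g \<Rightarrow> 'a \<times> 'b" where
  "pair_config G x y = (\<lambda>k\<in>carrier G. (x k, y k))"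

context group
begin

lemma shift_apply [simp]: "h \<in> carrier G \<Longrightarrow> shift G g x h = x (inv g \<otimes> h)"
  by (simp add: shift_def)

text \<open>Equivariance gives \<open>f x g = f (shift G (inv g) x) \<one>\<close>, so a window for
  the single coordinate \<open>\<one>\<close>, obtained from compactness, serves every coordinate.
  Conversely, a local rule commutes with translations and reads finitely many coordinates at each
  position.\<close>

lemma curtis_hedlund_lyndon:
  assumes X: "subshift G A X" and Y: "Y \<subseteq> carrier G \<rightarrow>\<^sub>E B"
  shows "block_map G A X B Y f \<longleftrightarrow> f ` X \<subseteq> Y \<and> (\<exists>D. local_rule G D X f)"
proof
  have top: "topspace (subtopology (full_shift G A) X) = X"
    using subshift_subset[OF X] by (auto simp: topspace_full_shift)
  have shX: "shift G g x \<in> X" if "g \<in> carrier G" "x \<in> X" for g x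
    using X that by (simp add: subshift_def)
  {
    assume "block_map G A X B Y f"
    then have cont: "continuous_map (subtopology (full_shift G A) X) (full_shift G B) f"
      and img: "f ` X \<subseteq> Y"
      and equ: "\<And>g x. g \<in> carrier G \<Longrightarrow> x \<in> X \<Longrightarrow> f (shift G g x) = shift G g (f x)"
      unfolding block_map_def equivariant_map_def top continuous_map_in_subtopology
      by (auto simp: top)
    have "continuous_map (full_shift G B) (discrete_topology B) (\<lambda>x. x \<one>)"
      unfolding full_shift_def by (rule continuous_map_product_projection) simp
    then have "continuous_map (subtopology (full_shift G A) X) (discrete_topology B) ((\<lambda>x. x \<one>) \<circ> f)"
      using cont by (metis continuous_map_compose)
    then have "\<exists>D. finite D \<and> D \<subseteq> carrier G \<and>
        (\<forall>x\<in>X. \<forall>y\<in>X. (\<forall>d\<in>D. x d = y d) \<longrightarrow> f x \<one> = f y \<one>)"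
      by (simp add: continuous_map_discrete_window[OF X])
    then obtain D where D: "finite D" "D \<subseteq> carrier G"
      "\<And>x y. x \<in> X \<Longrightarrow> y \<in> X \<Longrightarrow> \<forall>d\<in>D. x d = y d \<Longrightarrow> f x \<one> = f y \<one>"
      by metis
    have "f x g = f y h" if x: "x \<in> X" "y \<in> X" "g \<in> carrier G" "h \<in> carrier G"
      and "same_pattern G D x g y h" for x y g h
    proof -
      have "\<forall>d\<in>D. shift G (inv g) x d = shift G (inv h) y d"
        using that D(2) by (auto simp: same_pattern_def subset_iff)
      then have "f (shift G (inv g) x) \<one> = f (shift G (inv h) y) \<one>"
        using D(3) shX x by simp
      then show ?thesis using equ x by simp
    qed
    then show "f ` X \<subseteq> Y \<and> (\<exists>D. local_rule G D X f)"
      using D(1,2) img unfolding local_rule_def by blast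
  }
  assume "f ` X \<subseteq> Y \<and> (\<exists>D. local_rule G D X f)"
  then obtain D where img: "f ` X \<subseteq> Y" and D: "local_rule G D X f" by blast
  have fD: "finite D" "D \<subseteq> carrier G" using D by (auto simp: local_rule_def)
  have fx: "f x \<in> carrier G \<rightarrow>\<^sub>E B" if "x \<in> X" for x using img Y that by blast
  have equ: "f (shift G g x) = shift G g (f x)" if gx: "g \<in> carrier G" "x \<in> X" for g x
  proof
    fix k
    show "f (shift G g x) k = shift G g (f x) k"
    proof (cases "k \<in> carrier G")
      case True
      then have "same_pattern G D (shift G g x) k x (inv g \<otimes> k)"
        using gx fD by (auto simp: same_pattern_def subset_iff m_assoc)
      then show ?thesis
        using local_ruleD[OF D shX[OF gx] gx(2) True] gx(1) True by simp
    next
      case False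
      then show ?thesis
        using PiE_arb[OF fx[OF shX[OF gx]]] by (simp add: shift_def)
    qed
  qed
  have "continuous_map (subtopology (full_shift G A) X) (discrete_topology B) (\<lambda>x. f x k)"
    if k: "k \<in> carrier G" for k
    unfolding continuous_map_discrete_window[OF X]
  proof (intro conjI exI[of _ "(\<otimes>) k ` D"] ballI impI)
    fix x y assume "x \<in> X" "y \<in> X" "\<forall>d\<in>(\<otimes>) k ` D. x d = y d"
    then show "f x k = f y k"
      by (intro local_ruleD[OF D _ _ k k]) (simp_all add: same_pattern_def)
  next
    show "(\<lambda>x. f x k) ` X \<subseteq> B" using fx k by (auto simp: PiE_iff)
    show "finite ((\<otimes>) k ` D)" "(\<otimes>) k ` D \<subseteq> carrier G" using fD k by auto
  qed
  moreover have "f ` X \<subseteq> extensional (carrier G)" using fx by (auto simp: PiE_iff)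
  ultimately have "continuous_map (subtopology (full_shift G A) X) (full_shift G B) f"
    unfolding full_shift_def[of G B] continuous_map_componentwise top by blast
  then show "block_map G A X B Y f"
    using img equ unfolding block_map_def equivariant_map_def
    by (auto simp: top continuous_map_in_subtopology)
qed

text \<open>From forbidden patterns, \<open>W\<close> is the union of their supports. From a window,
  the patterns on \<open>W\<close> that no point of \<open>X\<close> carries are forbidden; they are
  finitely many because \<open>A\<close> and \<open>W\<close> are finite.\<close>

lemma finite_type_iff_window:
  assumes X: "subshift G A X"
  shows "finite_type G A X \<longleftrightarrow> (\<exists>W. finite W \<and> W \<subseteq> carrier G \<and>
    (\<forall>x\<in>carrier G \<rightarrow>\<^sub>E A. (\<forall>g\<in>carrier G. \<exists>y\<in>X. same_pattern G W x g y g) \<longrightarrow> x \<in> X))"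
    (is "_ \<longleftrightarrow> (\<exists>W. ?window W)")
proof
  assume "finite_type G A X"
  then obtain F where F: "finite F" "\<And>P. P \<in> F \<Longrightarrow> finite_pattern G A P"
      "X = {x \<in> topspace (full_shift G A). \<forall>P\<in>F. \<not> appears G P x}"
    unfolding finite_type_def by auto
  let ?W = "\<Union> (fst ` F)"
  have W: "finite ?W" "?W \<subseteq> carrier G"
    using F(1) F(2) by (auto simp: finite_pattern_def split_beta)
  have "x \<in> X" if x: "x \<in> carrier G \<rightarrow>\<^sub>E A"
    and loc: "\<forall>g\<in>carrier G. \<exists>y\<in>X. same_pattern G ?W x g y g" for x
  proof -
    have "\<not> appears G P x" if P: "P \<in> F" for P
    proof
      assume "appears G P x"
      then obtain g where g: "g \<in> carrier G" "\<forall>d\<in>fst P. x (g \<otimes> d) = snd P d"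
        by (auto simp: appears_def split_beta)
      from loc g(1) obtain y where "y \<in> X" "same_pattern G ?W x g y g" by blast
      then have "appears G P y"
        using g P by (auto simp: appears_def same_pattern_def split_beta intro!: bexI[of _ g])
      then show False using \<open>y \<in> X\<close> F(3) P by auto
    qed
    then show ?thesis using x F(3) by (simp add: topspace_full_shift)
  qed
  then have "?window ?W" using W by simp
  then show "\<exists>W. ?window W" ..
next
  assume "\<exists>W. ?window W"
  then obtain W where W: "finite W" "W \<subseteq> carrier G"
    "\<forall>x\<in>carrier G \<rightarrow>\<^sub>E A. (\<forall>g\<in>carrier G. \<exists>y\<in>X. same_pattern G W x g y g) \<longrightarrow> x \<in> X"
    by (elim exE conjE) (rule that)
  have shX: "shift G g x \<in> X" if "g \<in> carrier G" "x \<in> X" for g x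
    using X that by (simp add: subshift_def)
  define F where "F = Pair W ` {p \<in> W \<rightarrow>\<^sub>E A. \<not> (\<exists>y\<in>X. \<forall>w\<in>W. y w = p w)}"
  have "finite F"
    unfolding F_def using W(1) X by (intro finite_imageI finite_Collect_conjI disjI1)
      (simp add: finite_PiE subshift_def)
  moreover have "\<forall>P\<in>F. finite_pattern G A P"
    using W by (auto simp: F_def finite_pattern_def)
  moreover have "X = {x \<in> topspace (full_shift G A). \<forall>P\<in>F. \<not> appears G P x}"
  proof (intro equalityI subsetI CollectI conjI)
    fix x assume x: "x \<in> X"
    then show "x \<in> topspace (full_shift G A)"
      using subshift_in_full_shift[OF X] by (simp add: topspace_full_shift)
    show "\<forall>P\<in>F. \<not> appears G P x"
    proof (intro ballI notI)
      fix P assume "P \<in> F" "appears G P x"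
      then obtain p g where p: "\<not> (\<exists>y\<in>X. \<forall>w\<in>W. y w = p w)" "g \<in> carrier G"
          "\<forall>w\<in>W. x (g \<otimes> w) = p w"
        by (auto simp: F_def appears_def)
      then have "\<forall>w\<in>W. shift G (inv g) x w = p w"
        using W(2) by (auto simp: subset_iff)
      then show False using p shX[of "inv g" x] x by blast
    qed
  next
    fix x assume x: "x \<in> {x \<in> topspace (full_shift G A). \<forall>P\<in>F. \<not> appears G P x}"
    then have xA: "x \<in> carrier G \<rightarrow>\<^sub>E A" by (simp add: topspace_full_shift)
    show "x \<in> X"
    proof (rule W(3)[rule_format, OF xA])
      fix g assume g: "g \<in> carrier G"
      let ?p = "\<lambda>w\<in>W. x (g \<otimes> w)"
      have "appears G (W, ?p) x"
        using g by (auto simp: appears_def)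
      moreover have "?p \<in> W \<rightarrow>\<^sub>E A"
        using xA g W(2) by (auto simp: PiE_iff subset_iff)
      ultimately have "\<exists>y\<in>X. \<forall>w\<in>W. y w = ?p w"
        using x unfolding F_def by blast
      then obtain y where y: "y \<in> X" "\<forall>w\<in>W. y w = x (g \<otimes> w)"
        by auto
      \<comment> \<open>The pattern of \<open>x\<close> around \<open>g\<close> sits around the
        identity in \<open>y\<close>; shifting \<open>y\<close> by \<open>g\<close> moves it to
        \<open>g\<close>.\<close>
      then have "same_pattern G W x g (shift G g y) g"
        using g W(2) by (auto simp: same_pattern_def subset_iff inv_solve_left' simp flip: m_assoc)
      then show "\<exists>y\<in>X. same_pattern G W x g y g" using shX g y(1) by blast
    qed
  qed
  ultimately show "finite_type G A X" unfolding finite_type_def by blast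
qed

text \<open>Left translation by \<open>h \<otimes> inv g\<close> carries the window at
  \<open>g\<close> to the window at \<open>h\<close>. This lets a witness from a shift-invariant set
  be moved to another base point.\<close>

lemma same_pattern_shift:
  assumes "D \<subseteq> carrier G" "g \<in> carrier G" "h \<in> carrier G"
  shows "same_pattern G D x g (shift G (h \<otimes> inv g) x) h"
proof -
  have "inv (h \<otimes> inv g) \<otimes> (h \<otimes> d) = g \<otimes> d" if "d \<in> carrier G" for d
    using assms(2,3) that by (simp add: inv_mult_group m_assoc inv_solve_left')
  then show ?thesis
    using assms by (auto simp: same_pattern_def subset_iff)
qed

section \<open>Subshifts and morphisms given by symbol maps\<close>

lemma subshift_preimage:
  assumes "subshift G A X" "finite B" "e \<in> B \<rightarrow> A"
  shows "subshift G B {z \<in> carrier G \<rightarrow>\<^sub>E B. recode G e z \<in> X}"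
proof -
  have "closedin (full_shift G B) {z \<in> topspace (full_shift G B). recode G e z \<in> X}"
    using closedin_continuous_map_preimage[OF continuous_map_recode[OF assms(3), of G]] assms(1)
    by (simp add: subshift_def)
  then show ?thesis
    using assms(1,2) by (simp add: subshift_def topspace_full_shift
        shift_in_full_shift[OF is_group] recode_shift[OF is_group])
qed

text \<open>Restricting the symbols gives a box of subsets of a discrete alphabet, hence a closed
  set.\<close>

lemma subshift_symbols:
  assumes "finite B"
  shows "subshift G B {z \<in> carrier G \<rightarrow>\<^sub>E B. \<forall>k\<in>carrier G. z k \<in> C}"
proof -
  have eq: "{z \<in> carrier G \<rightarrow>\<^sub>E B. \<forall>k\<in>carrier G. z k \<in> C} = carrier G \<rightarrow>\<^sub>E B \<inter> C"
    unfolding PiE_iff PiE_def Pi_def by auto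
  have "closedin (full_shift G B) (carrier G \<rightarrow>\<^sub>E B \<inter> C)"
    unfolding full_shift_def closedin_product_topology by auto
  then show ?thesis
    using assms unfolding eq subshift_def by (simp add: shift_in_full_shift[OF is_group])
qed

lemma subshift_Int: "subshift G A X \<Longrightarrow> subshift G A Y \<Longrightarrow> subshift G A (X \<inter> Y)"
  by (auto simp: subshift_def)

lemma subshift_Un: "subshift G A X \<Longrightarrow> subshift G A Y \<Longrightarrow> subshift G A (X \<union> Y)"
  by (auto simp: subshift_def)

text \<open>A symbol map commutes with the shift, so whatever fixes \<open>z\<close> fixes its
  image. The auxiliary subshifts to which the extension property is applied get
  \<open>le_per\<close> from such a projection to \<open>X\<close>.\<close>

lemma le_per_factor:
  assumes "recode G e ` Z \<subseteq> X"
  shows "le_per G Z X"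
proof -
  have "stabilizer G (shift G) z \<subseteq> stabilizer G (shift G) (recode G e z)" for z
    using recode_shift[OF is_group, of _ e z, symmetric] by (auto simp: stabilizer_def)
  then show ?thesis using assms unfolding le_per_def by blast
qed

lemma block_map_recodeI:
  assumes "Z \<subseteq> carrier G \<rightarrow>\<^sub>E B" "e \<in> B \<rightarrow> A" "recode G e ` Z \<subseteq> X"
  shows "block_map G B Z A X (recode G e)"
  using assms continuous_map_recode[OF assms(2), of G] recode_shift[OF is_group]
  unfolding block_map_def equivariant_map_def
  by (auto simp: continuous_map_in_subtopology intro: continuous_map_from_subtopology)

subsection \<open>The map extension property implies finite type\<close>

lemma pair_config_in_full_shift:
  "x \<in> carrier G \<rightarrow>\<^sub>E A \<Longrightarrow> y \<in> carrier G \<rightarrow>\<^sub>E B \<Longrightarrow> pair_config G x y \<in> carrier G \<rightarrow>\<^sub>E A \<times> B"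
  by (auto simp: pair_config_def PiE_iff)

lemma recode_fst_pair_config:
  assumes "x \<in> carrier G \<rightarrow>\<^sub>E A"
  shows "recode G fst (pair_config G x y) = x"
  using PiE_arb[OF assms] by (auto simp: pair_config_def recode_def)

lemma recode_snd_pair_config:
  assumes "y \<in> carrier G \<rightarrow>\<^sub>E A"
  shows "recode G snd (pair_config G x y) = y"
  using PiE_arb[OF assms] by (auto simp: pair_config_def recode_def)

lemma recode_comp: "recode G (e \<circ> e') x = recode G e (recode G e' x)"
  by (auto simp: recode_def)

lemma same_pattern_pair_config:
  assumes "D \<subseteq> carrier G" "g \<in> carrier G" "h \<in> carrier G"
  shows "same_pattern G D (pair_config G x y) g (pair_config G x' y') h \<longleftrightarrow>
    same_pattern G D x g x' h \<and> same_pattern G D y g y' h"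
  using assms by (auto simp: same_pattern_def pair_config_def subset_iff)

text \<open>Extend the first projection \<open>X \<times> X \<rightarrow> X\<close> to \<open>A\<^sup>G \<times> X\<close>. If \<open>x\<close> looks like points of \<open>X\<close>
  through the window of the extension \<open>f\<close>, then \<open>f (x, y) = x\<close>. The second factor only
  serves to guarantee \<open>le_per\<close>.\<close>

lemma map_extension_imp_finite_type:
  assumes X: "subshift G A X" and ext: "map_extension_property G A X"
  shows "finite_type G A X"
proof -
  let ?B = "A \<times> A"
  \<comment> \<open>\<open>Z\<close> codes the product of the full shift with \<open>X\<close>, and
    \<open>Z'\<close> codes \<open>X \<times> X\<close>.\<close>
  define Z where "Z = {z \<in> carrier G \<rightarrow>\<^sub>E ?B. recode G snd z \<in> X}"
  define Z' where "Z' = Z \<inter> {z \<in> carrier G \<rightarrow>\<^sub>E ?B. recode G fst z \<in> X}"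
  have fin: "finite ?B" using X by (simp add: subshift_def)
  have maps: "fst \<in> ?B \<rightarrow> A" "snd \<in> ?B \<rightarrow> A" by auto
  have Z: "subshift G ?B Z"
    unfolding Z_def by (rule subshift_preimage[OF X fin maps(2)])
  have Z': "subshift G ?B Z'"
    unfolding Z'_def by (rule subshift_Int[OF Z subshift_preimage[OF X fin maps(1)]])
  have le: "le_per G Z X" by (rule le_per_factor[of snd]) (auto simp: Z_def)
  have "block_map G ?B Z' A X (recode G fst)"
    by (rule block_map_recodeI[OF subshift_subset[OF Z'] maps(1)]) (auto simp: Z'_def)
  then obtain f where f: "block_map G ?B Z A X f" "\<forall>z\<in>Z'. f z = recode G fst z"
    using map_extension_property_alphabet[OF is_group ext Z le Z'] by (auto simp: Z'_def)
  then obtain D where img: "f ` Z \<subseteq> X" and D: "local_rule G D Z f"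
    unfolding curtis_hedlund_lyndon[OF Z subshift_subset[OF X]] by blast
  have fD: "finite D" "D \<subseteq> carrier G" using D by (auto simp: local_rule_def)
  have inZ: "pair_config G x y \<in> Z" if "x \<in> carrier G \<rightarrow>\<^sub>E A" "y \<in> X" for x y
    using that subshift_in_full_shift[OF X that(2)]
    by (simp add: Z_def pair_config_in_full_shift recode_snd_pair_config)
  have fpair: "f (pair_config G x y) = x" if "x \<in> X" "y \<in> X" for x y
    using that inZ f(2) subshift_in_full_shift[OF X]
    by (simp add: Z'_def recode_fst_pair_config[of x A] pair_config_in_full_shift)
  have "x \<in> X" if x: "x \<in> carrier G \<rightarrow>\<^sub>E A"
    and loc: "\<forall>g\<in>carrier G. \<exists>y\<in>X. same_pattern G (insert \<one> D) x g y g" for x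
  proof -
    \<comment> \<open>The local condition at any position supplies a point of \<open>X\<close>, kept
      as the second coordinate throughout.\<close>
    obtain y0 where y0: "y0 \<in> X" using loc by blast
    have fxX: "f (pair_config G x y0) \<in> X" using inZ[OF x y0] img by blast
    have "f (pair_config G x y0) k = x k" for k
    proof (cases "k \<in> carrier G")
      case k: True
      then obtain y where y: "y \<in> X" "same_pattern G (insert \<one> D) x k y k" using loc by blast
      \<comment> \<open>Within the window at \<open>k\<close>, the first coordinate \<open>x\<close>
        may be replaced by \<open>y\<close>, for which \<open>f\<close> is the first projection. The
        inserted \<open>\<one>\<close> then gives \<open>y k = x k\<close>.\<close>
      then have "same_pattern G D (pair_config G x y0) k (pair_config G y y0) k"
        using fD k by (simp add: same_pattern_pair_config) (simp add: same_pattern_def)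
      then have "f (pair_config G x y0) k = f (pair_config G y y0) k"
        using inZ x y0 subshift_in_full_shift[OF X y(1)] k by (intro local_ruleD[OF D]) auto
      also have "\<dots> = x k"
        using same_patternD[OF y(2), of \<one>] fpair[OF y(1) y0] k by simp
      finally show ?thesis .
    next
      case False
      then show ?thesis using PiE_arb x subshift_in_full_shift[OF X fxX] by metis
    qed
    then have "f (pair_config G x y0) = x" ..
    then show ?thesis using fxX by simp
  qed
  then show ?thesis
    unfolding finite_type_iff_window[OF X] using fD by (intro exI[of _ "insert \<one> D"]) auto
qed

end

subsection \<open>Contractions as local rules\<close>

text \<open>The product \<open>I \<times> X \<times> X\<close> as one subshift, so that the
  extension property and \<open>curtis_hedlund_lyndon\<close> apply to contractions.\<close>

definition triples ::
  "('a, 'b) monoid_scheme \<Rightarrow> 'x set \<Rightarrow> ('a \<Rightarrow> 'x) set \<Rightarrow> ('a \<Rightarrow> nat \<times> 'x \<times> 'x) set" where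
  "triples G A X = {z \<in> carrier G \<rightarrow>\<^sub>E {0, 1} \<times> A \<times> A.
     recode G (fst \<circ> snd) z \<in> X \<and> recode G (snd \<circ> snd) z \<in> X}"

context group
begin

lemma triples_maps:
  "fst \<in> {0, 1 :: nat} \<times> A \<times> A \<rightarrow> {0, 1}" "fst \<circ> snd \<in> {0, 1 :: nat} \<times> A \<times> A \<rightarrow> A"
  "snd \<circ> snd \<in> {0, 1 :: nat} \<times> A \<times> A \<rightarrow> A"
  by auto

lemma subshift_triples:
  assumes X: "subshift G A X"
  shows "subshift G ({0, 1} \<times> A \<times> A) (triples G A X)"
proof -
  let ?B = "{0, 1 :: nat} \<times> A \<times> A"
  have fin: "finite ?B" using X by (simp add: subshift_def)
  have "triples G A X = {z \<in> carrier G \<rightarrow>\<^sub>E ?B. recode G (fst \<circ> snd) z \<in> X} \<inter>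
      {z \<in> carrier G \<rightarrow>\<^sub>E ?B. recode G (snd \<circ> snd) z \<in> X}"
    by (auto simp: triples_def)
  then show ?thesis
    using subshift_Int[OF subshift_preimage[OF X fin triples_maps(2)]
        subshift_preimage[OF X fin triples_maps(3)]] by simp
qed

lemma triple_config_in_triples:
  assumes X: "subshift G A X" and "t \<in> carrier G \<rightarrow>\<^sub>E {0, 1}" "x \<in> X" "y \<in> X"
  shows "pair_config G t (pair_config G x y) \<in> triples G A X"
proof -
  note xy = subshift_in_full_shift[OF X assms(3)] subshift_in_full_shift[OF X assms(4)]
  note xy_in = pair_config_in_full_shift[OF xy]
  show ?thesis
    using assms pair_config_in_full_shift[OF assms(2) xy_in]
    unfolding triples_def recode_comp
    by (simp add: recode_fst_pair_config[OF xy(1)] recode_snd_pair_config[OF xy(2)]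
        recode_snd_pair_config[OF xy_in])
qed

lemma shift_pair_config:
  assumes "g \<in> carrier G"
  shows "shift G g (pair_config G x y) = pair_config G (shift G g x) (shift G g y)"
  using assms by (auto simp: shift_def pair_config_def)

text \<open>Checked at each coordinate, where the discrete topology on \<open>A \<times> B\<close>
  is the product of the discrete topologies.\<close>

lemma continuous_map_pair_config:
  "continuous_map (prod_topology (full_shift G A) (full_shift G B)) (full_shift G (A \<times> B))
     (\<lambda>(x, y). pair_config G x y)"
proof -
  have "continuous_map (prod_topology (full_shift G A) (full_shift G B)) (discrete_topology (A \<times> B))
      (\<lambda>p. (fst p k, snd p k))" if k: "k \<in> carrier G" for k
  proof -
    have "continuous_map (full_shift G C) (discrete_topology C) (\<lambda>x. x k)" for C :: "'y set"
      unfolding full_shift_def using k by (rule continuous_map_product_projection)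
    moreover have "continuous_map (full_shift G C) (discrete_topology C) (\<lambda>x. x k)" for C :: "'z set"
      unfolding full_shift_def using k by (rule continuous_map_product_projection)
    ultimately show ?thesis
      unfolding prod_topology_discrete_topology
      by (intro continuous_map_pairedI continuous_map_compose[OF continuous_map_fst, unfolded o_def]
          continuous_map_compose[OF continuous_map_snd, unfolded o_def])
  qed
  then show ?thesis
    unfolding full_shift_def[of G "A \<times> B"] continuous_map_componentwise
    by (auto simp: pair_config_def split_beta)
qed

abbreviation contraction_domain ::
  "'y set \<Rightarrow> ('a \<Rightarrow> 'y) set \<Rightarrow> (('a \<Rightarrow> nat) \<times> ('a \<Rightarrow> 'y) \<times> ('a \<Rightarrow> 'y)) topology" where
  "contraction_domain A X \<equiv> prod_topology (full_shift G {0, 1})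
     (prod_topology (subtopology (full_shift G A) X) (subtopology (full_shift G A) X))"

text \<open>Precomposing with the continuous, equivariant packing of three configurations into one
  turns a block map on \<open>triples\<close> into a map of the form required by
  \<open>contraction\<close>.\<close>

lemma equivariant_map_triple_config:
  assumes X: "subshift G A X" and f: "block_map G ({0, 1} \<times> A \<times> A) (triples G A X) A X f"
  shows "equivariant_map G (contraction_domain A X)
    (\<lambda>g (t, x, y). (shift G g t, shift G g x, shift G g y))
    (subtopology (full_shift G A) X) (shift G)
    (\<lambda>(t, x, y). f (pair_config G t (pair_config G x y)))"
proof -
  let ?T = "subtopology (full_shift G A) X"
  have top: "topspace ?T = X" "topspace (full_shift G {0, 1 :: nat}) = carrier G \<rightarrow>\<^sub>E {0, 1}"
    "topspace (subtopology (full_shift G ({0, 1} \<times> A \<times> A)) (triples G A X)) = triples G A X"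
    using subshift_subset[OF X] subshift_subset[OF subshift_triples[OF X]]
    by (auto simp: topspace_full_shift)
  have sub: "continuous_map ?T (full_shift G A) (\<lambda>x. x)"
    by (simp add: continuous_map_from_subtopology)
  have "continuous_map (prod_topology ?T ?T) (prod_topology (full_shift G A) (full_shift G A))
      (\<lambda>p. (fst p, snd p))"
    by (intro continuous_map_pairedI continuous_map_compose[OF continuous_map_fst sub, unfolded o_def]
        continuous_map_compose[OF continuous_map_snd sub, unfolded o_def])
  from continuous_map_compose[OF this continuous_map_pair_config, unfolded o_def split_beta fst_conv snd_conv]
  have pair: "continuous_map (prod_topology ?T ?T) (full_shift G (A \<times> A)) (\<lambda>p. pair_config G (fst p) (snd p))"
    .
  have "continuous_map (contraction_domain A X)
      (prod_topology (full_shift G {0, 1}) (full_shift G (A \<times> A)))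
      (\<lambda>p. (fst p, pair_config G (fst (snd p)) (snd (snd p))))"
    by (intro continuous_map_pairedI continuous_map_fst
        continuous_map_compose[OF continuous_map_snd pair, unfolded o_def])
  from continuous_map_compose[OF this continuous_map_pair_config, unfolded o_def split_beta fst_conv snd_conv]
  have triple: "continuous_map (contraction_domain A X) (full_shift G ({0, 1} \<times> A \<times> A))
      (\<lambda>p. pair_config G (fst p) (pair_config G (fst (snd p)) (snd (snd p))))"
    .
  have "continuous_map (contraction_domain A X)
      (subtopology (full_shift G ({0, 1} \<times> A \<times> A)) (triples G A X))
      (\<lambda>p. pair_config G (fst p) (pair_config G (fst (snd p)) (snd (snd p))))"
    by (rule continuous_map_into_subtopology[OF triple])
      (use triple_config_in_triples[OF X] top in auto)
  then have "continuous_map (contraction_domain A X) ?T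
      (f \<circ> (\<lambda>p. pair_config G (fst p) (pair_config G (fst (snd p)) (snd (snd p)))))"
    by (rule continuous_map_compose) (use f in \<open>simp add: block_map_def equivariant_map_def\<close>)
  then have "continuous_map (contraction_domain A X) ?T
      (\<lambda>(t, x, y). f (pair_config G t (pair_config G x y)))"
    by (simp only: o_def case_prod_unfold)
  moreover have "f (pair_config G (shift G g t) (pair_config G (shift G g x) (shift G g y))) =
      shift G g (f (pair_config G t (pair_config G x y)))"
    if "g \<in> carrier G" "t \<in> carrier G \<rightarrow>\<^sub>E {0, 1}" "x \<in> X" "y \<in> X" for g t x y
    using f triple_config_in_triples[OF X that(2-4)] that(1)
    unfolding block_map_def equivariant_map_def top shift_pair_config[OF that(1), symmetric]
    by blast
  ultimately show ?thesis
    unfolding equivariant_map_def topspace_prod_topology top by auto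
qed

text \<open>The reverse translation: three symbol maps unpack a configuration before
  \<open>h\<close> is applied.\<close>

lemma block_map_triples:
  assumes X: "subshift G A X"
    and h: "equivariant_map G (contraction_domain A X)
      (\<lambda>g (t, x, y). (shift G g t, shift G g x, shift G g y))
      (subtopology (full_shift G A) X) (shift G) h"
  shows "block_map G ({0, 1} \<times> A \<times> A) (triples G A X) A X
    (\<lambda>z. h (recode G fst z, recode G (fst \<circ> snd) z, recode G (snd \<circ> snd) z))"
proof -
  let ?S = "subtopology (full_shift G ({0, 1} \<times> A \<times> A)) (triples G A X)"
  have top: "topspace ?S = triples G A X"
    using subshift_subset[OF subshift_triples[OF X]] by (auto simp: topspace_full_shift)
  note cont = continuous_map_from_subtopology[OF continuous_map_recode[OF triples_maps(1)]]
    continuous_map_from_subtopology[OF continuous_map_recode[OF triples_maps(2)]]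
    continuous_map_from_subtopology[OF continuous_map_recode[OF triples_maps(3)]]
  have un: "continuous_map ?S (contraction_domain A X)
      (\<lambda>z. (recode G fst z, recode G (fst \<circ> snd) z, recode G (snd \<circ> snd) z))"
    by (intro continuous_map_pairedI continuous_map_into_subtopology cont)
      (auto simp: top triples_def)
  have "continuous_map ?S (subtopology (full_shift G A) X)
      (\<lambda>z. h (recode G fst z, recode G (fst \<circ> snd) z, recode G (snd \<circ> snd) z))"
    using continuous_map_compose[OF un, of "subtopology (full_shift G A) X" h] h
    unfolding equivariant_map_def o_def by blast
  moreover have "h (recode G fst (shift G g z), recode G (fst \<circ> snd) (shift G g z),
        recode G (snd \<circ> snd) (shift G g z)) =
      shift G g (h (recode G fst z, recode G (fst \<circ> snd) z, recode G (snd \<circ> snd) z))"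
    if "g \<in> carrier G" "z \<in> triples G A X" for g z
  proof -
    have "(recode G fst z, recode G (fst \<circ> snd) z, recode G (snd \<circ> snd) z) \<in>
        topspace (contraction_domain A X)"
      using continuous_map_image_subset_topspace[OF un] that(2) top by blast
    then show ?thesis
      using h that(1) unfolding equivariant_map_def recode_shift[OF is_group that(1)] by fastforce
  qed
  ultimately show ?thesis
    unfolding block_map_def equivariant_map_def top by blast
qed

text \<open>The window of the associated block map on \<open>triples\<close>, split into its three
  components. It allows values of \<open>h\<close> to be compared when the arguments agree only near
  the positions concerned.\<close>

lemma contraction_window:
  assumes X: "subshift G A X" and h: "contraction G A X h"
  obtains D where "finite D" "D \<subseteq> carrier G"
    "\<And>t x y t' x' y' g g'. \<lbrakk>t \<in> carrier G \<rightarrow>\<^sub>E {0, 1}; x \<in> X; y \<in> X;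
       t' \<in> carrier G \<rightarrow>\<^sub>E {0, 1}; x' \<in> X; y' \<in> X; g \<in> carrier G; g' \<in> carrier G;
       same_pattern G D t g t' g'; same_pattern G D x g x' g'; same_pattern G D y g y' g'\<rbrakk>
       \<Longrightarrow> h (t, x, y) g = h (t', x', y') g'"
    "\<And>t x y. \<lbrakk>t \<in> carrier G \<rightarrow>\<^sub>E {0, 1}; x \<in> X; y \<in> X\<rbrakk> \<Longrightarrow> h (t, x, y) \<in> X"
proof -
  define F where "F z = h (recode G fst z, recode G (fst \<circ> snd) z, recode G (snd \<circ> snd) z)" for z
  have "block_map G ({0, 1} \<times> A \<times> A) (triples G A X) A X F"
    using block_map_triples[OF X] h unfolding F_def contraction_def by blast
  then obtain D where img: "F ` triples G A X \<subseteq> X" and D: "local_rule G D (triples G A X) F"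
    unfolding curtis_hedlund_lyndon[OF subshift_triples[OF X] subshift_subset[OF X]] by blast
  have fD: "finite D" "D \<subseteq> carrier G" using D by (auto simp: local_rule_def)
  have F: "F (pair_config G t (pair_config G x y)) = h (t, x, y)"
    if "t \<in> carrier G \<rightarrow>\<^sub>E {0, 1}" "x \<in> X" "y \<in> X" for t x y
  proof -
    note xy = subshift_in_full_shift[OF X that(2)] subshift_in_full_shift[OF X that(3)]
    show ?thesis
      unfolding F_def recode_comp recode_fst_pair_config[OF that(1)]
        recode_snd_pair_config[OF pair_config_in_full_shift[OF xy]]
        recode_fst_pair_config[OF xy(1)] recode_snd_pair_config[OF xy(2)] ..
  qed
  show thesis
  proof (rule that[OF fD])
    fix t t' :: "'a \<Rightarrow> nat" and x y x' y' g g'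
    assume *: "t \<in> carrier G \<rightarrow>\<^sub>E {0, 1}" "x \<in> X" "y \<in> X"
       "t' \<in> carrier G \<rightarrow>\<^sub>E {0, 1}" "x' \<in> X" "y' \<in> X" "g \<in> carrier G" "g' \<in> carrier G"
       "same_pattern G D t g t' g'" "same_pattern G D x g x' g'" "same_pattern G D y g y' g'"
    have "F (pair_config G t (pair_config G x y)) g = F (pair_config G t' (pair_config G x' y')) g'"
      using * fD triple_config_in_triples[OF X]
      by (intro local_ruleD[OF D]) (simp_all add: same_pattern_pair_config)
    then show "h (t, x, y) g = h (t', x', y') g'" using F * by simp
  next
    fix t :: "'a \<Rightarrow> nat" and x y assume *: "t \<in> carrier G \<rightarrow>\<^sub>E {0, 1}" "x \<in> X" "y \<in> X"
    show "h (t, x, y) \<in> X"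
      using img triple_config_in_triples[OF X *] F[OF *] by auto
  qed
qed

text \<open>On the union of \<open>t = 0\<close>, \<open>t = 1\<close> and \<open>x = y\<close>, the required values of a strong contraction
  are given by the single symbol map \<open>(t, x, y) \<mapsto> if t = 0 then x else y\<close>.\<close>

lemma map_extension_imp_strongly_contractible:
  assumes X: "subshift G A X" and ext: "map_extension_property G A X"
  shows "strongly_contractible_subshift G A X"
proof -
  let ?B = "{0, 1 :: nat} \<times> A \<times> A"
  let ?e = "\<lambda>(t :: nat, x :: 'c, y). if t = 0 then x else y"
  define Sym where "Sym C = {z \<in> carrier G \<rightarrow>\<^sub>E ?B. \<forall>k\<in>carrier G. z k \<in> C}" for C
  let ?Z = "triples G A X"
  \<comment> \<open>The third piece, the diagonal, is what makes the resulting contraction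
    strong.\<close>
  define Z' where "Z' = ?Z \<inter> (Sym {c. fst c = 0} \<union> Sym {c. fst c = 1} \<union> Sym {c. fst (snd c) = snd (snd c)})"
  have fin: "finite ?B" using X by (simp add: subshift_def)
  have Sym: "subshift G ?B (Sym C)" for C unfolding Sym_def by (rule subshift_symbols[OF fin])
  have Z: "subshift G ?B ?Z" by (rule subshift_triples[OF X])
  have Z': "subshift G ?B Z'" unfolding Z'_def by (intro subshift_Int subshift_Un Z Sym)
  have le: "le_per G ?Z X" by (rule le_per_factor[of "fst \<circ> snd"]) (auto simp: triples_def)
  have "recode G ?e z \<in> X" if z: "z \<in> Z'" for z
  proof -
    \<comment> \<open>A symbolwise mixture of two points of \<open>X\<close> need not lie in
      \<open>X\<close>, but on each of the three pieces it is one of the two points.\<close>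
    have "recode G ?e z = recode G (fst \<circ> snd) z \<or> recode G ?e z = recode G (snd \<circ> snd) z"
    proof -
      consider "\<forall>k\<in>carrier G. fst (z k) = 0" | "\<forall>k\<in>carrier G. fst (z k) = 1"
        | "\<forall>k\<in>carrier G. fst (snd (z k)) = snd (snd (z k))"
        using z unfolding Z'_def Sym_def by auto
      then show ?thesis
        by cases (auto simp: recode_def split_beta)
    qed
    then show ?thesis using z unfolding Z'_def triples_def by auto
  qed
  then have "block_map G ?B Z' A X (recode G ?e)"
    by (intro block_map_recodeI[OF subshift_subset[OF Z']]) auto
  then obtain f where f: "block_map G ?B ?Z A X f" "\<forall>z\<in>Z'. f z = recode G ?e z"
    using map_extension_property_alphabet[OF is_group ext Z le Z'] by (auto simp: Z'_def)
  let ?h = "\<lambda>(t, x, y). f (pair_config G t (pair_config G x y))"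
  have val: "?h (t, x, y) = (\<lambda>k\<in>carrier G. if t k = 0 then x k else y k)"
    if t: "t \<in> carrier G \<rightarrow>\<^sub>E {0, 1}" "x \<in> X" "y \<in> X"
      and cases: "(\<forall>k\<in>carrier G. t k = 0) \<or> (\<forall>k\<in>carrier G. t k = 1) \<or> x = y" for t x y
  proof -
    have "pair_config G t (pair_config G x y) \<in> Z'"
    proof -
      let ?z = "pair_config G t (pair_config G x y)"
      have z: "?z \<in> ?Z" by (rule triple_config_in_triples[OF X t])
      moreover have "?z \<in> carrier G \<rightarrow>\<^sub>E ?B" using z by (simp add: triples_def)
      moreover have "?z k = (t k, x k, y k)" if "k \<in> carrier G" for k
        using that by (simp add: pair_config_def)
      ultimately show ?thesis using cases unfolding Z'_def Sym_def by auto
    qed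
    then show ?thesis using f(2) by (auto simp: recode_def pair_config_def)
  qed
  have restr: "(\<lambda>k\<in>carrier G. x k) = x" if "x \<in> X" for x
    using subshift_in_full_shift[OF X that] by (simp add: PiE_restrict)
  have "?h (\<lambda>_\<in>carrier G. 0, x, y) = x \<and> ?h (\<lambda>_\<in>carrier G. 1, x, y) = y"
    if "x \<in> X" "y \<in> X" for x y
    using val[of "\<lambda>_\<in>carrier G. 0" x y] val[of "\<lambda>_\<in>carrier G. 1" x y] that restr
    by (simp cong: restrict_cong)
  moreover have "?h (t, x, x) = x" if "t \<in> carrier G \<rightarrow>\<^sub>E {0, 1}" "x \<in> X" for t x
    using val[OF that(1,2,2)] restr[OF that(2)] by simp
  ultimately have "contraction G A X ?h \<and>
      (\<forall>t\<in>topspace (full_shift G {0, 1}). \<forall>x\<in>X. ?h (t, x, x) = x)"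
    unfolding contraction_def topspace_full_shift
    using equivariant_map_triple_config[OF X f(1)] by blast
  then show ?thesis unfolding strongly_contractible_subshift_def by blast
qed

end

subsection \<open>Gluing along a contraction\<close>

context group
begin

text \<open>Let \<open>t\<close> mark by 0 the positions at which \<open>z\<close> looks like a point of \<open>Z'\<close> through a large window.
  Near a marked position, \<open>g\<close> is defined on \<open>z\<close> by locality, and \<open>h (t, g z, f\<^sub>0 z)\<close> makes sense;
  away from marked positions it would return \<open>f\<^sub>0 z\<close>. Since \<open>X\<close> has finite type,
  the configuration glued from these values belongs to \<open>X\<close>.\<close>

lemma contractible_finite_type_extension:
  fixes Z :: "('a \<Rightarrow> 'z) set" and X :: "('a \<Rightarrow> 'x) set"
  assumes X: "subshift G A X" and h: "contraction G A X h" and ft: "finite_type G A X"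
    and Z: "subshift G B Z" and Z': "subshift G B Z'" "Z' \<subseteq> Z"
    and g: "block_map G B Z' A X g" and f0: "block_map G B Z A X f0"
  shows "\<exists>f. block_map G B Z A X f \<and> (\<forall>z\<in>Z'. f z = g z)"
proof -
  note XA = subshift_in_full_shift[OF X]
  obtain K where gX: "g ` Z' \<subseteq> X" and K: "local_rule G K Z' g"
    using g unfolding curtis_hedlund_lyndon[OF Z'(1) subshift_subset[OF X]] by blast
  obtain K0 where f0X: "f0 ` Z \<subseteq> X" and K0: "local_rule G K0 Z f0"
    using f0 unfolding curtis_hedlund_lyndon[OF Z subshift_subset[OF X]] by blast
  have fK: "finite K" "K \<subseteq> carrier G" "finite K0" "K0 \<subseteq> carrier G"
    using K K0 by (auto simp: local_rule_def)
  obtain W1 where W1: "finite W1" "W1 \<subseteq> carrier G"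
    "\<forall>x\<in>carrier G \<rightarrow>\<^sub>E A. (\<forall>g\<in>carrier G. \<exists>y\<in>X. same_pattern G W1 x g y g) \<longrightarrow> x \<in> X"
    using ft[unfolded finite_type_iff_window[OF X]] by (elim exE conjE) (rule that)
  obtain D1 where D1: "finite D1" "D1 \<subseteq> carrier G"
    and hD1: "\<And>t x y t' x' y' k k'. \<lbrakk>t \<in> carrier G \<rightarrow>\<^sub>E {0, 1}; x \<in> X; y \<in> X;
       t' \<in> carrier G \<rightarrow>\<^sub>E {0, 1}; x' \<in> X; y' \<in> X; k \<in> carrier G; k' \<in> carrier G;
       same_pattern G D1 t k t' k'; same_pattern G D1 x k x' k'; same_pattern G D1 y k y' k'\<rbrakk>
       \<Longrightarrow> h (t, x, y) k = h (t', x', y') k'"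
    and hX: "\<And>t x y. \<lbrakk>t \<in> carrier G \<rightarrow>\<^sub>E {0, 1}; x \<in> X; y \<in> X\<rbrakk> \<Longrightarrow> h (t, x, y) \<in> X"
    by (rule contraction_window[OF X h]) (rule that)
  have h01: "h (\<lambda>_\<in>carrier G. 0, x, y) = x" "h (\<lambda>_\<in>carrier G. 1, x, y) = y"
    if "x \<in> X" "y \<in> X" for x y
    using h that by (auto simp: contraction_def)
  \<comment> \<open>\<open>\<one> \<in> W\<close> forces the glued values to lie in
    \<open>A\<close>; \<open>\<one> \<in> D\<close> makes each position part of its own
    \<open>D\<close>-window.\<close>
  define W where "W = insert \<one> W1"
  define D where "D = insert \<one> D1"
  have W: "finite W" "W \<subseteq> carrier G" "\<one> \<in> W" and D: "finite D" "D \<subseteq> carrier G" "\<one> \<in> D"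
    using W1 D1 by (auto simp: W_def D_def)
  have hD: "h (t, x, y) k = h (t', x', y') k'"
    if "t \<in> carrier G \<rightarrow>\<^sub>E {0, 1}" "x \<in> X" "y \<in> X"
       "t' \<in> carrier G \<rightarrow>\<^sub>E {0, 1}" "x' \<in> X" "y' \<in> X" "k \<in> carrier G" "k' \<in> carrier G"
       "\<And>d. d \<in> D \<Longrightarrow> t (k \<otimes> d) = t' (k' \<otimes> d)" "\<And>d. d \<in> D \<Longrightarrow> x (k \<otimes> d) = x' (k' \<otimes> d)"
       "\<And>d. d \<in> D \<Longrightarrow> y (k \<otimes> d) = y' (k' \<otimes> d)" for t x y t' x' y' k k'
    by (rule hD1) (use that in \<open>auto simp: D_def same_pattern_def\<close>)

  \<comment> \<open>\<open>E\<close> contains every displacement from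
    \<open>k \<otimes> w \<otimes> d\<close> to
    \<open>k \<otimes> w' \<otimes> d' \<otimes> e\<close>. Thus one match of \<open>z\<close> with
    \<open>z'\<close> through \<open>E\<close> gives matches through \<open>K\<close> at all
    positions whose values of \<open>g\<close> matter for gluing around \<open>k\<close>; this is
    \<open>windows\<close>.\<close>
  define E where "E = (\<lambda>(w, d, w', d', e). inv (w \<otimes> d) \<otimes> (w' \<otimes> (d' \<otimes> e))) ` (W \<times> D \<times> W \<times> D \<times> K)"
  have E: "finite E" "E \<subseteq> carrier G"
    using W(1) D(1) fK(1) W(2) D(2) fK(2) by (auto simp: E_def subset_iff)
  define N where "N z k \<longleftrightarrow> (\<exists>z'\<in>Z'. same_pattern G E z k z' k)" for z k
  define t where "t z = (\<lambda>k\<in>carrier G. if N z k then 0 else 1 :: nat)" for z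
  \<comment> \<open>\<open>z'\<close> witnesses that some position in the \<open>D\<close>-window of
    \<open>k\<close> is marked 0.\<close>
  define C where "C z k z' \<longleftrightarrow> z' \<in> Z' \<and> (\<exists>d\<in>D. same_pattern G E z (k \<otimes> d) z' (k \<otimes> d))" for z k z'
  \<comment> \<open>The chosen \<open>z'\<close> varies with \<open>k\<close>, so \<open>f z\<close>
    need not be a single value of \<open>h\<close>; \<open>f_near\<close> shows that the choice is
    immaterial.\<close>
  define f where "f z = (\<lambda>k\<in>carrier G.
    if \<exists>z'. C z k z' then h (t z, g (SOME z'. C z k z'), f0 z) k else f0 z k)" for z

  have t01: "t z \<in> carrier G \<rightarrow>\<^sub>E {0, 1}" for z by (auto simp: t_def)
  have N_cong: "N z2 k2" if "N z k" "same_pattern G E z k z2 k2" "k \<in> carrier G" "k2 \<in> carrier G"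
    for z k z2 k2
  proof -
    obtain z' where z': "z' \<in> Z'" "same_pattern G E z k z' k" using \<open>N z k\<close> N_def by blast
    let ?z = "shift G (k2 \<otimes> inv k) z'"
    have "same_pattern G E z2 k2 ?z k2"
      using that(2) z'(2) same_pattern_shift[OF E(2) that(3,4), of z']
      by (metis same_pattern_sym same_pattern_trans)
    moreover have "?z \<in> Z'" using Z'(1) z'(1) that(3,4) by (simp add: subshift_def)
    ultimately show ?thesis unfolding N_def by blast
  qed
  have windows: "same_pattern G K z (k \<otimes> w' \<otimes> d') z' (k \<otimes> w' \<otimes> d')"
    if "same_pattern G E z (k \<otimes> w \<otimes> d) z' (k \<otimes> w \<otimes> d)" "k \<in> carrier G"
      "w \<in> W" "d \<in> D" "w' \<in> W" "d' \<in> D" for z z' k w d w' d'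
    unfolding same_pattern_def
  proof
    fix e assume e: "e \<in> K"
    have car: "w \<in> carrier G" "d \<in> carrier G" "w' \<in> carrier G" "d' \<in> carrier G" "e \<in> carrier G"
      using that e W D fK by auto
    let ?u = "inv (w \<otimes> d) \<otimes> (w' \<otimes> (d' \<otimes> e))"
    have "?u \<in> E" unfolding E_def using that e by force
    moreover have "k \<otimes> w \<otimes> d \<otimes> ?u = k \<otimes> w' \<otimes> d' \<otimes> e"
    proof -
      have "k \<otimes> w \<otimes> d \<otimes> ?u = k \<otimes> ((w \<otimes> d) \<otimes> inv (w \<otimes> d)) \<otimes> (w' \<otimes> (d' \<otimes> e))"
        using car that(2) by (simp add: m_assoc del: r_inv Units_r_inv)
      then show ?thesis using car that(2) by (simp add: m_assoc)
    qed
    ultimately show "z (k \<otimes> w' \<otimes> d' \<otimes> e) = z' (k \<otimes> w' \<otimes> d' \<otimes> e)"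
      using same_patternD[OF that(1)] by metis
  qed
  have CK: "same_pattern G K z (k \<otimes> d) z' (k \<otimes> d)" if "C z k z'" "k \<in> carrier G" "d \<in> D" for z k z' d
    using that windows[of z k \<one> _ z' \<one> d] W(3) unfolding C_def by auto
  \<comment> \<open>Only the values of \<open>g z'\<close> on the \<open>D\<close>-window of
    \<open>k\<close> enter, and locality of \<open>g\<close> determines them from \<open>z\<close>.
    Hence any \<open>z'\<close> matching \<open>z\<close> there may replace the chosen one.\<close>
  have f_near: "f z k = h (t z, g z', f0 z) k"
    if z: "z \<in> Z" "k \<in> carrier G" and z': "z' \<in> Z'" "\<And>d. d \<in> D \<Longrightarrow> same_pattern G K z (k \<otimes> d) z' (k \<otimes> d)"
      and ex: "\<exists>z'. C z k z'" for z k z'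
  proof -
    let ?s = "SOME z'. C z k z'"
    have s: "C z k ?s" using ex by (rule someI_ex)
    then have sZ: "?s \<in> Z'" by (simp add: C_def)
    have "g ?s (k \<otimes> d) = g z' (k \<otimes> d)" if d: "d \<in> D" for d
    proof (rule local_ruleD[OF K sZ z'(1)])
      show "same_pattern G K ?s (k \<otimes> d) z' (k \<otimes> d)"
        using z'(2)[OF d] CK[OF s z(2) d] by (metis same_pattern_sym same_pattern_trans)
    qed (use D(2) d z(2) in auto)
    then have "h (t z, g ?s, f0 z) k = h (t z, g z', f0 z) k"
      using t01 gX f0X z sZ z'(1) by (intro hD) auto
    then show ?thesis using ex z(2) by (simp add: f_def)
  qed
  have f_far: "f z k = f0 z k" if "k \<in> carrier G" "\<not> (\<exists>z'. C z k z')" for z k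
    using that by (auto simp: f_def)
  have t_far: "t z (k \<otimes> d) = 1" if "k \<in> carrier G" "\<not> (\<exists>z'. C z k z')" "d \<in> D" for z k d
    using that D(2) unfolding t_def C_def N_def by auto

  \<comment> \<open>If some \<open>k \<otimes> w\<close> has a witness \<open>z'\<close>, the choice
    of \<open>E\<close> makes the same \<open>z'\<close> usable at all \<open>k \<otimes> v\<close>.
    Positions with a witness of their own are handled by \<open>f_near\<close>; at the others
    \<open>t z\<close> is 1 on the whole window, so \<open>h\<close> returns \<open>f0 z\<close> as
    \<open>f\<close> does. If no position has a witness, \<open>f0 z\<close> itself is the required
    point.\<close>
  have glued: "\<exists>y\<in>X. same_pattern G W (f z) k y k" if z: "z \<in> Z" and k: "k \<in> carrier G" for z k
  proof (cases "\<exists>w\<in>W. \<exists>z'. C z (k \<otimes> w) z'")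
    case False
    then have "same_pattern G W (f z) k (f0 z) k"
      using f_far W(2) k by (auto simp: same_pattern_def)
    then show ?thesis using f0X z by blast
  next
    case True
    then obtain w z' d where w: "w \<in> W" "z' \<in> Z'" "d \<in> D"
        "same_pattern G E z (k \<otimes> w \<otimes> d) z' (k \<otimes> w \<otimes> d)"
      unfolding C_def by blast
    let ?y = "h (t z, g z', f0 z)"
    have "f z (k \<otimes> v) = ?y (k \<otimes> v)" if v: "v \<in> W" for v
    proof (cases "\<exists>z'. C z (k \<otimes> v) z'")
      case True
      then show ?thesis
        using f_near[OF z _ w(2) _ True] windows[OF w(4) k w(1,3) v] k v W(2) by auto
    next
      case False
      have kv: "k \<otimes> v \<in> carrier G" using k v W(2) by auto
      have "?y (k \<otimes> v) = h (\<lambda>_\<in>carrier G. 1, g z', f0 z) (k \<otimes> v)"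
        using t_far[OF kv False] t01 gX f0X z w(2) kv D(2) by (intro hD) auto
      also have "\<dots> = f0 z (k \<otimes> v)" using h01 gX f0X w(2) z by (simp add: image_subset_iff)
      finally show ?thesis using f_far[OF kv False] by simp
    qed
    then have "same_pattern G W (f z) k ?y k" by (simp add: same_pattern_def)
    moreover have "?y \<in> X"
      by (rule hX[OF t01]) (use gX f0X w(2) z in auto)
    ultimately show ?thesis by blast
  qed
  have fX: "f z \<in> X" if z: "z \<in> Z" for z
  proof -
    have "f z k \<in> A" if k: "k \<in> carrier G" for k
    proof -
      obtain y where "y \<in> X" "same_pattern G W (f z) k y k" using glued[OF z k] by blast
      then show ?thesis
        using same_patternD[of G W "f z" k y k \<one>] W(3) k XA[of y] by (auto simp: PiE_iff)
    qed
    then have "f z \<in> carrier G \<rightarrow>\<^sub>E A" by (auto simp: f_def)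
    moreover have "\<exists>y\<in>X. same_pattern G W1 (f z) k y k" if "k \<in> carrier G" for k
      using glued[OF z that] by (auto simp: W_def same_pattern_def)
    ultimately show ?thesis using W1(3) by blast
  qed

  \<comment> \<open>Around each position \<open>k \<otimes> d\<close>, \<open>E\<close> determines
    the mark, \<open>K\<close> the value of \<open>g\<close> on a witness, and \<open>K0\<close> the
    value of \<open>f0\<close>.\<close>
  define R where "R = (\<lambda>(d, e). d \<otimes> e) ` (D \<times> (E \<union> K \<union> K0))"
  have R: "same_pattern G (E \<union> K \<union> K0) z (k \<otimes> d) z2 (k2 \<otimes> d)"
    if "same_pattern G R z k z2 k2" "k \<in> carrier G" "k2 \<in> carrier G" "d \<in> D" for z k z2 k2 d
    unfolding same_pattern_def
  proof
    fix e assume e: "e \<in> E \<union> K \<union> K0"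
    then have "d \<otimes> e \<in> R" using \<open>d \<in> D\<close> by (force simp: R_def)
    moreover have "d \<in> carrier G" "e \<in> carrier G" using e E fK D that by auto
    ultimately show "z (k \<otimes> d \<otimes> e) = z2 (k2 \<otimes> d \<otimes> e)"
      using same_patternD[OF that(1)] that(2,3) by (simp add: m_assoc)
  qed
  have f_local: "f z k = f z2 k2"
    if z: "z \<in> Z" "z2 \<in> Z" and k: "k \<in> carrier G" "k2 \<in> carrier G" and same: "same_pattern G R z k z2 k2"
    for z z2 k k2
  proof -
    have kd: "k \<otimes> d \<in> carrier G" "k2 \<otimes> d \<in> carrier G" if "d \<in> D" for d using k D(2) that by auto
    have sE: "same_pattern G E z (k \<otimes> d) z2 (k2 \<otimes> d)"
      and sK: "same_pattern G K z (k \<otimes> d) z2 (k2 \<otimes> d)"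
      and sK0: "same_pattern G K0 z (k \<otimes> d) z2 (k2 \<otimes> d)" if "d \<in> D" for d
      using R[OF same k that] by (auto simp: same_pattern_def)
    have N: "N z (k \<otimes> d) \<longleftrightarrow> N z2 (k2 \<otimes> d)" if "d \<in> D" for d
      using N_cong sE[OF that] kd[OF that] same_pattern_sym by metis
    have f0: "f0 z (k \<otimes> d) = f0 z2 (k2 \<otimes> d)" if "d \<in> D" for d
      using local_ruleD[OF K0 z kd[OF that] sK0[OF that]] .
    have C_N: "(\<exists>z'. C z k z') \<longleftrightarrow> (\<exists>d\<in>D. N z (k \<otimes> d))" for z k
      by (auto simp: C_def N_def)
    show ?thesis
    proof (cases "\<exists>z'. C z k z'")
      case True
      then have "\<exists>z'. C z2 k2 z'" using N unfolding C_N by blast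
      with True obtain z' z2' where C: "C z k z'" "C z2 k2 z2'" by blast
      then have Z'm: "z' \<in> Z'" "z2' \<in> Z'" by (auto simp: C_def)
      \<comment> \<open>The two witnesses may be unrelated points of \<open>Z'\<close>, but through
        \<open>K\<close> they copy \<open>z\<close> and \<open>z2\<close>, whose patterns
        agree.\<close>
      have "g z' (k \<otimes> d) = g z2' (k2 \<otimes> d)" if d: "d \<in> D" for d
      proof (rule local_ruleD[OF K Z'm kd[OF d]])
        show "same_pattern G K z' (k \<otimes> d) z2' (k2 \<otimes> d)"
          using CK[OF C(1) k(1) d] CK[OF C(2) k(2) d] sK[OF d]
          by (metis same_pattern_sym same_pattern_trans)
      qed
      then have "h (t z, g z', f0 z) k = h (t z2, g z2', f0 z2) k2"
        using t01 gX f0X z Z'm k f0 N kd by (intro hD) (auto simp: t_def)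
      moreover have "f z k = h (t z, g z', f0 z) k"
        using f_near[OF z(1) k(1) Z'm(1)] CK[OF C(1) k(1)] C(1) by blast
      moreover have "f z2 k2 = h (t z2, g z2', f0 z2) k2"
        using f_near[OF z(2) k(2) Z'm(2)] CK[OF C(2) k(2)] C(2) by blast
      ultimately show ?thesis by simp
    next
      case False
      moreover from this have "\<not> (\<exists>z'. C z2 k2 z')" using N unfolding C_N by blast
      ultimately show ?thesis
        using f_far k f0[OF D(3)] by simp
    qed
  qed
  have "local_rule G R Z f"
    unfolding local_rule_def using f_local D E fK by (auto simp: R_def subset_iff)
  then have "block_map G B Z A X f"
    unfolding curtis_hedlund_lyndon[OF Z subshift_subset[OF X]] using fX by blast
  \<comment> \<open>A point of \<open>Z'\<close> is its own witness everywhere, so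
    \<open>t z\<close> is constantly 0 and \<open>h\<close> returns \<open>g z\<close>.\<close>
  moreover have "f z = g z" if z: "z \<in> Z'" for z
  proof
    fix k
    have zZ: "z \<in> Z" using z Z'(2) by blast
    show "f z k = g z k"
    proof (cases "k \<in> carrier G")
      case True
      have "C z k z" using z D(3) by (auto simp: C_def same_pattern_def)
      then have "f z k = h (t z, g z, f0 z) k"
        using f_near[OF zZ True z] by (auto simp: same_pattern_def)
      moreover have "N z j" for j using z by (auto simp: N_def same_pattern_def)
      then have "t z = (\<lambda>_\<in>carrier G. 0)" by (simp add: t_def)
      ultimately show ?thesis using h01 gX f0X z zZ by (simp add: image_subset_iff)
    next
      case False
      then show ?thesis using PiE_arb[of _ "carrier G"] XA fX[OF zZ] gX z by (metis image_subset_iff)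
    qed
  qed
  ultimately show ?thesis by blast
qed

end

theorem theorem8p22:
  fixes G :: "('g, 'm) monoid_scheme" and A :: "'a set" and X :: "('g \<Rightarrow> 'a) set"
  assumes "group G" and "finitely_generated G" and "infinite (carrier G)"
    and "subshift G A X"
  shows "(map_extension_property G A X \<longleftrightarrow>
            contractible_subshift G A X \<and> finite_type G A X \<and> map_existence_property G A X) \<and>
         (map_extension_property G A X \<longleftrightarrow>
            strongly_contractible_subshift G A X \<and> finite_type G A X \<and> map_existence_property G A X)"
proof -
  interpret group G by fact
  have "map_existence_property G A X" if ext: "map_extension_property G A X"
    unfolding map_existence_property_def
  proof (intro allI impI)
    fix B :: "nat set" and Z
    assume Z: "subshift G B Z \<and> le_per G Z X"
    \<comment> \<open>Existence is extension from the empty subshift, on which any function is a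
      morphism.\<close>
    have empty: "subshift G B {}" using Z by (simp add: subshift_def)
    then have "block_map G B {} A X undefined"
      using curtis_hedlund_lyndon[OF empty subshift_subset[OF assms(4)]]
      by (auto simp: local_rule_def)
    with Z empty show "\<exists>f. block_map G B Z A X f"
      using ext[unfolded map_extension_property_def] by blast
  qed
  \<comment> \<open>The existence property supplies the fallback morphism \<open>f0\<close> for the
    gluing.\<close>
  moreover have "map_extension_property G A X"
    if "contractible_subshift G A X" "finite_type G A X" "map_existence_property G A X"
    using that contractible_finite_type_extension[OF assms(4)]
    unfolding map_extension_property_def map_existence_property_def contractible_subshift_def
    by meson
  moreover have "contractible_subshift G A X" if "strongly_contractible_subshift G A X"
    using that unfolding contractible_subshift_def strongly_contractible_subshift_def by blast
  ultimately show ?thesis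
    using map_extension_imp_finite_type[OF assms(4)]
      map_extension_imp_strongly_contractible[OF assms(4)] by blast
qed

end
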